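(* Let $h\geq 1$ be an integer and let $A$ be a finite set of $k$ nonnegative integers with $0\in A$. Then \[|h_{\pm}A| \geq 2hk-2h+1.\] This lower bound is best possible: for $A=\{0,1,\ldots,k-1\}$ one has $|h_{\pm}A|=2hk-2h+1$.
   Context: For a finite set $A=\{a_0,a_1,\ldots,a_{k-1}\}$ of integers and a positive integer $h$, the $h$-fold signed sumset of $A$ is \[h_{\pm}A=\Big\{\sum_{i=0}^{k-1}\lambda_i a_i : (\lambda_0,\ldots,\lambda_{k-1})\in\mathbb{Z}^k,\ \sum_{i=0}^{k-1}|\lambda_i|=h\Big\}.\] *)

theory Defs
  imports Main
begin

text \<open>The coefficient tuple is indexed by the elements of \<open>A\<close> themselves; only the
  values of \<open>l\<close> on \<open>A\<close> matter. Intended for finite \<open>A\<close>.\<close>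

definition signed_sumset :: "nat \<Rightarrow> int set \<Rightarrow> int set" where
  "signed_sumset h A =
     {(\<Sum>a\<in>A. l a * a) | l :: int \<Rightarrow> int. (\<Sum>a\<in>A. \<bar>l a\<bar>) = int h}"

end

theory Submission
  imports Defs
begin

text \<open>As \<open>0 \<in> A\<close>, the coefficient of \<open>0\<close> absorbs any deficit, so the condition
  \<open>\<Sum>\<bar>l a\<bar> = h\<close> may be relaxed to \<open>\<Sum>\<bar>l a\<bar> \<le> h\<close>, and \<open>h\<^sub>\<plusminus>A\<close> is the ordinary
  \<open>h\<close>-fold sumset of \<open>B = A \<union> -A\<close>, where \<open>card B = 2k - 1\<close>. With \<open>m = Max A\<close>, the set
  \<open>(h + 1)\<^sub>\<plusminus>A\<close> contains \<open>h\<^sub>\<plusminus>A - m\<close>, whose maximum is \<open>h m - m\<close>, together with the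
  \<open>2k - 2\<close> larger elements \<open>h m + b\<close> for \<open>b \<in> B\<close>, \<open>b \<noteq> -m\<close>. The bound follows by
  induction on \<open>h\<close>, and it is attained by an interval because
  \<open>h\<^sub>\<plusminus>A \<subseteq> [-h m, h m]\<close>.\<close>

lemma signed_sumset_memI:
  fixes l :: "int \<Rightarrow> int"
  assumes "finite A" "0 \<in> A" and le: "(\<Sum>a\<in>A. \<bar>l a\<bar>) \<le> int h"
  shows "(\<Sum>a\<in>A. l a * a) \<in> signed_sumset h A"
proof -
  define r where "r = (\<Sum>a\<in>A - {0}. \<bar>l a\<bar>)"
  \<comment> \<open>The old coefficient of 0 is overwritten, not increased, so the new one only has
    to match the weight \<open>r\<close> of the remaining elements.\<close>
  define l' where "l' = l(0 := int h - r)"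
  have "(\<Sum>a\<in>A. \<bar>l a\<bar>) = \<bar>l 0\<bar> + r"
    unfolding r_def using assms by (simp add: sum.remove)
  with le have "r \<le> int h" by linarith
  have "(\<Sum>a\<in>A - {0}. \<bar>l' a\<bar>) = r"
    unfolding r_def l'_def by (rule sum.cong) auto
  hence "(\<Sum>a\<in>A. \<bar>l' a\<bar>) = int h"
    using \<open>r \<le> int h\<close> sum.remove[OF assms(1,2), of "\<lambda>a. \<bar>l' a\<bar>"] by (simp add: l'_def)
  moreover have "(\<Sum>a\<in>A. l a * a) = (\<Sum>a\<in>A. l' a * a)"
    unfolding l'_def by (rule sum.cong) auto
  ultimately show ?thesis
    unfolding signed_sumset_def by blast
qed

text \<open>Changing one coefficient by 1 or -1 can also shrink its absolute value, so the total
  weight is only known to be at most \<open>Suc h\<close>; the relaxed membership criterion covers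
  this.\<close>

lemma signed_sumset_add:
  assumes "finite A" "0 \<in> A" "s \<in> signed_sumset h A" "b \<in> A \<union> uminus ` A"
  shows "s + b \<in> signed_sumset (Suc h) A"
proof -
  obtain l where l: "s = (\<Sum>a\<in>A. l a * a)" "(\<Sum>a\<in>A. \<bar>l a\<bar>) = int h"
    using assms(3) unfolding signed_sumset_def by blast
  obtain c e :: int where ce: "c \<in> A" "\<bar>e\<bar> = 1" "b = e * c"
  proof (cases "b \<in> A")
    case True
    then show ?thesis using that[of b 1] by simp
  next
    case False
    then show ?thesis using that[of "- b" "-1"] assms(4) by auto
  qed
  define l' where "l' a = l a + (if a = c then e else 0)" for a
  have "(\<Sum>a\<in>A. l' a * a) = (\<Sum>a\<in>A. l a * a + (if a = c then e * c else 0))"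
    unfolding l'_def by (rule sum.cong) (auto simp: algebra_simps)
  also have "\<dots> = s + b"
    using ce assms(1) l by (simp add: sum.distrib)
  finally have "(\<Sum>a\<in>A. l' a * a) = s + b" .
  moreover have "(\<Sum>a\<in>A. \<bar>l' a\<bar>) \<le> (\<Sum>a\<in>A. \<bar>l a\<bar> + (if a = c then 1 else 0))"
    unfolding l'_def using ce by (intro sum_mono) auto
  hence "(\<Sum>a\<in>A. \<bar>l' a\<bar>) \<le> int (Suc h)"
    using ce assms(1) l by (simp add: sum.distrib)
  ultimately show ?thesis
    using signed_sumset_memI[OF assms(1,2)] by metis
qed

text \<open>The triangle inequality. It serves for finiteness, for the upper end of the sumset in
  the induction, and for the upper bound in the extremal example.\<close>

lemma signed_sumset_subset_interval:
  assumes "\<And>a. a \<in> A \<Longrightarrow> \<bar>a\<bar> \<le> m"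
  shows "signed_sumset h A \<subseteq> {- (int h * m)..int h * m}"
proof
  fix s assume "s \<in> signed_sumset h A"
  then obtain l where l: "s = (\<Sum>a\<in>A. l a * a)" "(\<Sum>a\<in>A. \<bar>l a\<bar>) = int h"
    unfolding signed_sumset_def by blast
  have "\<bar>s\<bar> \<le> (\<Sum>a\<in>A. \<bar>l a * a\<bar>)"
    unfolding l(1) by (rule sum_abs)
  also have "\<dots> \<le> (\<Sum>a\<in>A. \<bar>l a\<bar> * m)"
    using assms by (intro sum_mono) (simp add: abs_mult mult_left_mono)
  also have "\<dots> = int h * m"
    by (simp add: l(2) flip: sum_distrib_right)
  finally show "s \<in> {- (int h * m)..int h * m}" by auto
qed

text \<open>Nonnegativity forces \<open>A\<close> and its negative to meet in 0 alone, so
  inclusion-exclusion loses exactly one element.\<close>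

lemma card_Un_uminus_image:
  fixes A :: "int set"
  assumes "finite A" "0 \<in> A" "\<And>a. a \<in> A \<Longrightarrow> 0 \<le> a"
  shows "card (A \<union> uminus ` A) = 2 * card A - 1"
proof -
  have "x = 0" if "x \<in> A" "x \<in> uminus ` A" for x
    using that assms(3)[of x] assms(3)[of "- x"] by auto
  moreover have "0 \<in> uminus ` A"
    using assms(2) by (rule rev_image_eqI) simp
  ultimately have "A \<inter> uminus ` A = {0}"
    using assms(2) by blast
  moreover have "card (uminus ` A) = card A"
    by (intro card_image) simp
  ultimately show ?thesis
    using card_Un_Int[of A "uminus ` A"] assms(1) by simp
qed

lemma card_signed_sumset_ge:
  assumes A: "finite A" "0 \<in> A" "\<And>a. a \<in> A \<Longrightarrow> 0 \<le> a"
  shows "h * (2 * card A - 2) + 1 \<le> card (signed_sumset h A)"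
proof -
  define m where "m = Max A"
  define B where "B = A \<union> uminus ` A"
  have m: "m \<in> A" "\<And>a. a \<in> A \<Longrightarrow> a \<le> m"
    using A unfolding m_def by (auto intro: Max_in)
  have abs_le: "\<bar>a\<bar> \<le> m" if "a \<in> A" for a
    using that A(3) m(2) by simp
  have B: "finite B" "\<And>b. b \<in> B \<Longrightarrow> - m \<le> b" "- m \<in> B" "m \<in> B"
    using A m abs_le unfolding B_def by fastforce+
  have card_B: "card (B - {- m}) = 2 * card A - 2"
    using card_Un_uminus_image[OF A] B by (simp add: B_def)
  have fin: "finite (signed_sumset n A)" for n
    using signed_sumset_subset_interval[OF abs_le] finite_subset by blast
  have zero: "0 \<in> signed_sumset 0 A"
    using signed_sumset_memI[OF A(1,2), of "\<lambda>_. 0" 0] by simp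
  have step: "s + b \<in> signed_sumset (Suc n) A" if "s \<in> signed_sumset n A" "b \<in> B" for s b n
    using signed_sumset_add[OF A(1,2) that(1)] that(2) unfolding B_def by blast
  have top: "int n * m \<in> signed_sumset n A" for n
  proof (induction n)
    case 0
    then show ?case using zero by simp
  next
    case (Suc n)
    then show ?case using step[OF Suc B(4)] by (simp add: algebra_simps)
  qed
  show ?thesis
  proof (induction h)
    case 0
    have "card (signed_sumset 0 A) > 0"
      using zero fin card_gt_0_iff by blast
    then show ?case by simp
  next
    case (Suc h)
    define L where "L = (\<lambda>s. s + - m) ` signed_sumset h A"
    \<comment> \<open>The choice \<open>b = - m\<close> would give \<open>int h * m - m\<close>,
      which already is the top element of \<open>L\<close>.\<close>
    define R where "R = (\<lambda>b. int h * m + b) ` (B - {- m})"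
    have "x \<le> int h * m - m" if "x \<in> L" for x
      using that signed_sumset_subset_interval[OF abs_le, of A h] unfolding L_def by force
    moreover have "int h * m - m < x" if "x \<in> R" for x
      using that B(2) unfolding R_def by fastforce
    ultimately have disj: "L \<inter> R = {}"
      by fastforce
    have "L \<union> R \<subseteq> signed_sumset (Suc h) A"
      using step[OF _ B(3)] step[OF top] unfolding L_def R_def by blast
    hence "card (L \<union> R) \<le> card (signed_sumset (Suc h) A)"
      using fin by (rule card_mono[rotated])
    moreover have "card (L \<union> R) = card L + card R"
      using disj fin B(1) by (intro card_Un_disjoint) (auto simp: L_def R_def)
    moreover have "card L = card (signed_sumset h A)"
      unfolding L_def by (intro card_image) (simp add: inj_on_def)
    moreover have "card R = 2 * card A - 2"
      unfolding R_def card_B[symmetric] by (intro card_image) (simp add: inj_on_def)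
    ultimately show ?case using Suc by simp
  qed
qed

text \<open>Since 0 lies in \<open>A\<close>, its cardinality is positive, so the truncated
  difference \<open>2 * card A - 2\<close> agrees with the integer one.\<close>

lemma int_card_signed_sumset_ge:
  assumes "finite A" "0 \<in> A" "\<And>a. a \<in> A \<Longrightarrow> 0 \<le> a"
  shows "2 * int h * int (card A) - 2 * int h + 1 \<le> int (card (signed_sumset h A))"
proof -
  have "card A \<ge> 1"
    using assms(1,2) by (simp add: Suc_le_eq card_gt_0_iff) blast
  then obtain j where "card A = Suc j"
    by (cases "card A") auto
  moreover have "int (h * (2 * card A - 2) + 1) \<le> int (card (signed_sumset h A))"
    using card_signed_sumset_ge[OF assms] by (simp only: of_nat_le_iff)
  ultimately show ?thesis
    by (simp add: algebra_simps)
qed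

theorem theorem5:
  fixes h :: nat
  assumes "h \<ge> 1"
  shows "(\<forall>(A :: int set) (k :: nat).
            finite A \<and> card A = k \<and> (\<forall>a\<in>A. 0 \<le> a) \<and> 0 \<in> A \<longrightarrow>
            int (card (signed_sumset h A)) \<ge> 2 * int h * int k - 2 * int h + 1)
       \<and> (\<forall>k::nat. k \<ge> 1 \<longrightarrow>
            int (card (signed_sumset h {0..int k - 1})) = 2 * int h * int k - 2 * int h + 1)"
proof (intro conjI allI impI)
  fix A :: "int set" and k :: nat
  assume "finite A \<and> card A = k \<and> (\<forall>a\<in>A. 0 \<le> a) \<and> 0 \<in> A"
  then show "int (card (signed_sumset h A)) \<ge> 2 * int h * int k - 2 * int h + 1"
    using int_card_signed_sumset_ge[of A h] by blast
next
  fix k :: nat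
  assume k: "k \<ge> 1"
  let ?A = "{0..int k - 1}" and ?N = "int h * (int k - 1)"
  have "card (signed_sumset h ?A) \<le> card {- ?N..?N}"
    by (intro card_mono signed_sumset_subset_interval) auto
  \<comment> \<open>This makes the cardinality of the interval exactly \<open>2 * ?N + 1\<close>,
    with no truncation at 0.\<close>
  moreover have "0 \<le> ?N"
    using k by simp
  ultimately have "int (card (signed_sumset h ?A)) \<le> 2 * ?N + 1"
    by simp
  moreover have "2 * int h * int k - 2 * int h + 1 \<le> int (card (signed_sumset h ?A))"
    using int_card_signed_sumset_ge[of ?A h] k by simp
  ultimately show "int (card (signed_sumset h ?A)) = 2 * int h * int k - 2 * int h + 1"
    by (simp add: algebra_simps)
qed

end
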